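(* For integers $k\ge n\ge 1$ let $G$ be chosen uniformly at random from $\mathcal{G}_{k,n}$ and let $T_n=T_n(k)$ be the largest size of a planar matching of $G$. (a) For every $\epsilon>0$ there are positive constants $C_0,C_1,C_2$ and a constant $0<D_0<1$ (not depending on $n$ or $k$) such that for all $n\ge C_0$ and all $k\ge n$, $$\mu_{low}:=(1-e^{-1})\sqrt{n}-\frac{17}{\sqrt{n}}\;\le\;\mathbb{E}T_n\;\le\;(e+\epsilon)\sqrt{n}+1=:\mu_{up},$$ $$\mathbb{P}\left(T_n\le\mu_{up}\right)\ge 1-e^{-C_1\sqrt{n}}\quad\text{and}\quad \mathbb{P}\left(T_n\ge(1-\epsilon)\mu_{low}\right)\ge 1-z_n,$$ where $z_n:=\min\left(D_0,\ \frac{C_2}{\sqrt{n}}+\frac{C_2 n}{k}\right)$. (b) For all integers $k\ge n\ge 2$ and every real $b=b(n)$ with $2<b\le\frac{n}{(32)^2\log n}$, $$\mathbb{P}\left(T_n\ge\sqrt{\frac{n}{b\log n}}\right)\ge 1-\exp\left(-\left(\frac{b}{2}-1\right)\log n\right).$$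
   Context: $K_{k,n}$ is the complete bipartite graph with $k$ top vertices $v_1,\ldots,v_k$ and $n$ bottom vertices $u_1,\ldots,u_n$. $\mathcal{G}_{k,n}$ is the set of all subgraphs of $K_{k,n}$ in which each bottom vertex $u_i$, $1\le i\le n$, is adjacent to exactly one top vertex and each top vertex is adjacent to at most one bottom vertex (equivalently, injections from $\{1,\ldots,n\}$ to $\{1,\ldots,k\}$). A planar matching of size $t$ in $G$ is a set of $t$ edges $(u_{i_1},v_{j_1}),\ldots,(u_{i_t},v_{j_t})$ of $G$ with $i_1<\cdots<i_t$ and $j_1<\cdots<j_t$. Logarithms are natural. *)

theory Defs
  imports "HOL-Probability.Probability"
begin

text \<open>
  A bipartite graph on bottom vertices \<open>u\<^sub>1, \<dots>, u\<^sub>n\<close> and top vertices \<open>v\<^sub>1, \<dots>, v\<^sub>k\<close>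
  is represented by its edge set: the pair \<open>(i, j)\<close> is the edge joining \<open>u\<^sub>i\<close> and \<open>v\<^sub>j\<close>.
  Subgraphs are spanning, so top vertices may be isolated.
\<close>

type_synonym bigraph = "(nat \<times> nat) set"

definition complete_bigraph :: "nat \<Rightarrow> nat \<Rightarrow> bigraph" where
  "complete_bigraph k n = {1..n} \<times> {1..k}"

definition matching_graphs :: "nat \<Rightarrow> nat \<Rightarrow> bigraph set" where
  "matching_graphs k n =
     {G. G \<subseteq> complete_bigraph k n \<and>
         (\<forall>i\<in>{1..n}. \<exists>!j. (i, j) \<in> G) \<and>
         (\<forall>j\<in>{1..k}. \<forall>i i'. (i, j) \<in> G \<longrightarrow> (i', j) \<in> G \<longrightarrow> i = i')}"

definition planar_matching :: "bigraph \<Rightarrow> nat \<Rightarrow> bigraph \<Rightarrow> bool" where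
  "planar_matching G t M \<longleftrightarrow>
     M \<subseteq> G \<and>
     (\<exists>i j :: nat \<Rightarrow> nat. strict_mono_on {1..t} i \<and> strict_mono_on {1..t} j \<and>
        M = (\<lambda>s. (i s, j s)) ` {1..t})"

text \<open>
  The maximum is over a nonempty set (\<open>t = 0\<close> with the empty matching always qualifies),
  which is finite when \<open>G\<close> is.
\<close>

definition max_planar_matching :: "bigraph \<Rightarrow> nat" where
  "max_planar_matching G = Max {t. \<exists>M. planar_matching G t M}"

definition random_matching_graph :: "nat \<Rightarrow> nat \<Rightarrow> bigraph pmf" where
  "random_matching_graph k n = pmf_of_set (matching_graphs k n)"

definition mu_low :: "nat \<Rightarrow> real" where
  "mu_low n = (1 - exp (-1)) * sqrt (real n) - 17 / sqrt (real n)"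

definition mu_up :: "real \<Rightarrow> nat \<Rightarrow> real" where
  "mu_up \<epsilon> n = (exp 1 + \<epsilon>) * sqrt (real n) + 1"

definition z_bound :: "real \<Rightarrow> real \<Rightarrow> nat \<Rightarrow> nat \<Rightarrow> real" where
  "z_bound D\<^sub>0 C\<^sub>2 k n = min D\<^sub>0 (C\<^sub>2 / sqrt (real n) + C\<^sub>2 * real n / real k)"

text \<open>
  \<^const>\<open>pmf_of_set\<close> is the uniform distribution only on finite nonempty sets, and
  \<^const>\<open>Max\<close> is meaningful only on such sets.
\<close>

lemma finite_matching_graphs: "finite (matching_graphs k n)"
proof (rule finite_subset)
  show "matching_graphs k n \<subseteq> Pow (complete_bigraph k n)"
    unfolding matching_graphs_def Collect_conj_eq Pow_def by (rule Int_lower1)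
  show "finite (Pow (complete_bigraph k n))"
    by (simp add: complete_bigraph_def)
qed

lemma matching_graphs_nonempty:
  assumes "n \<le> k"
  shows "matching_graphs k n \<noteq> {}"
proof -
  have "{(i, j). i = j \<and> 1 \<le> i \<and> i \<le> n} \<in> matching_graphs k n"
    unfolding matching_graphs_def complete_bigraph_def using assms by force
  then show ?thesis by blast
qed

lemma planar_matching_card:
  assumes "planar_matching G t M"
  shows "card M = t"
proof -
  obtain i j :: "nat \<Rightarrow> nat" where i: "strict_mono_on {1..t} i"
    and M: "M = (\<lambda>s. (i s, j s)) ` {1..t}"
    using assms unfolding planar_matching_def by blast
  have "inj_on (\<lambda>s. (i s, j s)) {1..t}"
    by (rule inj_onI) (metis prod.inject inj_onD[OF strict_mono_on_imp_inj_on[OF i]])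
  then show ?thesis
    using M by (simp add: card_image)
qed

lemma planar_matching_sizes:
  assumes "finite G"
  shows "finite {t. \<exists>M. planar_matching G t M}" "0 \<in> {t. \<exists>M. planar_matching G t M}"
proof -
  have "t \<le> card G" if "planar_matching G t M" for t M
    using card_mono[OF assms, of M] planar_matching_card[OF that] that
    by (simp add: planar_matching_def)
  then have "{t. \<exists>M. planar_matching G t M} \<subseteq> {..card G}" by auto
  then show "finite {t. \<exists>M. planar_matching G t M}" by (rule finite_subset) simp
  have "planar_matching G 0 {}" by (simp add: planar_matching_def strict_mono_on_def)
  then show "0 \<in> {t. \<exists>M. planar_matching G t M}" by blast
qed

end

theory Submission
  imports Defs "HOL-Combinatorics.Permutations" "HOL-Real_Asymp.Real_Asymp"
begin

text \<open>
  Only the relative order of the values matters, so \<open>T\<^sub>n\<close> is the length of the longest increasing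
  subsequence of a uniform permutation, whatever \<open>k\<close> is. By Erdos and Szekeres, the longest
  increasing length times the longest decreasing one is at least \<open>n\<close>, and reversal makes both
  equidistributed; hence the mean is at least \<open>\<surd>n\<close>, and an atypically short increasing
  subsequence forces an atypically long one in the reversed permutation. Long subsequences are
  excluded by the first moment bound \<open>P(T\<^sub>n \<ge> t) \<le> (n choose t) / t!\<close>. For the lower tail near the
  mean, the Efron-Stein inequality bounds the variance of the length by its mean, in the model of
  independent letters from an alphabet so large that repetitions are negligible.
\<close>

subsection \<open>Longest increasing subsequences\<close>

text \<open>The index set is arbitrary, not only \<open>{1..n}\<close>: later arguments restrict to
  the positions before and below a given one, or delete a single position.\<close>

definition lis :: "(nat \<Rightarrow> nat) \<Rightarrow> nat set \<Rightarrow> nat" where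
  "lis x I = Max (card ` {S. S \<subseteq> I \<and> strict_mono_on S x})"

lemma card_le_lis:
  assumes "finite I" "S \<subseteq> I" "strict_mono_on S x"
  shows "card S \<le> lis x I"
  unfolding lis_def using assms by (intro Max_ge) auto

lemma lis_witness:
  assumes "finite I"
  obtains S where "S \<subseteq> I" "strict_mono_on S x" "card S = lis x I"
proof -
  have "lis x I \<in> card ` {S. S \<subseteq> I \<and> strict_mono_on S x}"
    unfolding lis_def using assms by (intro Max_in) (auto intro!: exI[of _ "{}"])
  then show thesis using that by auto
qed

lemma lis_mono:
  assumes "finite J" "I \<subseteq> J"
  shows "lis x I \<le> lis x J"
proof -
  have "finite I" using assms finite_subset by blast
  then obtain S where "S \<subseteq> I" "strict_mono_on S x" "card S = lis x I" by (rule lis_witness)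
  then show ?thesis using card_le_lis[of J S x] assms by auto
qed

lemma lis_le_card:
  assumes "finite I"
  shows "lis x I \<le> card I"
proof -
  obtain S where "S \<subseteq> I" "card S = lis x I" by (rule lis_witness[OF assms])
  then show ?thesis by (metis assms card_mono)
qed

lemma lis_cong:
  assumes "\<And>i. i \<in> I \<Longrightarrow> x i = y i"
  shows "lis x I = lis y I"
proof -
  have "{S. S \<subseteq> I \<and> strict_mono_on S x} = {S. S \<subseteq> I \<and> strict_mono_on S y}"
    using assms by (auto simp: monotone_on_def) (metis subsetD)+
  then show ?thesis by (simp add: lis_def)
qed

lemma lis_comp_strict_mono:
  assumes "strict_mono_on (x ` I) f"
  shows "lis (\<lambda>i. f (x i)) I = lis x I"
proof -
  have "strict_mono_on S (\<lambda>i. f (x i)) \<longleftrightarrow> strict_mono_on S x" if "S \<subseteq> I" for S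
    using that strict_mono_on_less[OF assms]
    unfolding monotone_on_def by (meson imageI subsetD)
  then have "{S. S \<subseteq> I \<and> strict_mono_on S (\<lambda>i. f (x i))} = {S. S \<subseteq> I \<and> strict_mono_on S x}"
    by auto
  then show ?thesis by (simp add: lis_def)
qed

lemma strict_mono_on_insert_top:
  fixes x :: "nat \<Rightarrow> nat"
  assumes "strict_mono_on S x" "\<And>j. j \<in> S \<Longrightarrow> j < i \<and> x j < x i"
  shows "strict_mono_on (insert i S) x"
  using assms unfolding monotone_on_def by (metis insertE not_less_iff_gr_or_eq)

text \<open>
  Level sets of the length of the longest increasing subsequence arriving strictly below \<open>i\<close>
  are decreasing; the pigeonhole principle finds a large one.
\<close>

lemma erdos_szekeres:
  assumes fin: "finite I" and inj: "inj_on x I"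
  obtains S where "S \<subseteq> I" "strict_antimono_on S x" "card I \<le> lis x I * card S"
proof -
  define B where "B i = {j\<in>I. j < i \<and> x j < x i}" for i
  define a where "a i = lis x (B i)" for i
  have finB: "finite (B i)" for i using fin by (simp add: B_def)
  \<comment> \<open>\<open>i\<close> lies after and above all of \<open>B i\<close>, so appending it
    to a longest increasing set there gains one element. Hence \<open>a\<close> stays below
    \<open>lis x I\<close> on \<open>I\<close> and grows along every ascent.\<close>
  have ins: "\<exists>S. S \<subseteq> B i \<and> strict_mono_on (insert i S) x \<and> card (insert i S) = Suc (a i)" for i
  proof -
    obtain S where S: "S \<subseteq> B i" "strict_mono_on S x" "card S = a i"
      unfolding a_def by (rule lis_witness[OF finB])
    have "strict_mono_on (insert i S) x"
      by (rule strict_mono_on_insert_top[OF S(2)]) (use S(1) in \<open>auto simp: B_def\<close>)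
    moreover have "i \<notin> S" using S(1) by (auto simp: B_def)
    ultimately show ?thesis using S finB finite_subset by (metis card_insert_disjoint)
  qed
  have a_less: "a i < lis x I" if "i \<in> I" for i
  proof -
    obtain S where S: "S \<subseteq> B i" "strict_mono_on (insert i S) x" "card (insert i S) = Suc (a i)"
      using ins by blast
    have "insert i S \<subseteq> I" using S(1) that by (auto simp: B_def)
    then show ?thesis using card_le_lis[OF fin, of "insert i S" x] S by simp
  qed
  have a_mono: "a i < a j" if "i \<in> I" "i < j" "x i < x j" for i j
  proof -
    obtain S where S: "S \<subseteq> B i" "strict_mono_on (insert i S) x" "card (insert i S) = Suc (a i)"
      using ins by blast
    have "insert i S \<subseteq> B j" using S(1) that by (auto simp: B_def)
    then show ?thesis using card_le_lis[OF finB, of "insert i S" j x] S by (simp add: a_def)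
  qed
  define C where "C v = {i\<in>I. a i = v}" for v
  have "strict_antimono_on (C v) x" for v
  proof (rule monotone_onI)
    fix i j assume ij: "i \<in> C v" "j \<in> C v" "i < j"
    then have "\<not> x i < x j" using a_mono[of i j] by (auto simp: C_def)
    moreover have "x i \<noteq> x j" using ij inj by (auto simp: C_def inj_on_def)
    ultimately show "x j < x i" by simp
  qed
  moreover have "\<exists>v. card I \<le> lis x I * card (C v)"
  proof (cases "I = {}")
    case False
    \<comment> \<open>The values of \<open>a\<close> are the pigeonholes; some level set holds at
      least the average share of \<open>I\<close>.\<close>
    then have "{..<lis x I} \<noteq> {}" using a_less by auto
    then obtain v where "card I \<le> card (a -` {v} \<inter> I) * card {..<lis x I}"
      using pigeonhole_card[of a I "{..<lis x I}"] fin a_less by blast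
    moreover have "a -` {v} \<inter> I = C v" by (auto simp: C_def)
    ultimately show ?thesis by (auto simp: mult.commute)
  qed simp
  moreover have "C v \<subseteq> I" for v by (auto simp: C_def)
  ultimately show thesis using that by blast
qed

text \<open>Restriction to \<open>{1..n}\<close> keeps the reversal among the extensional functions,
  so that it is an involution on the injections.\<close>

definition rev_fun :: "nat \<Rightarrow> (nat \<Rightarrow> nat) \<Rightarrow> nat \<Rightarrow> nat" where
  "rev_fun n x = restrict (\<lambda>i. x (Suc n - i)) {1..n}"

text \<open>Reflecting positions by \<open>Suc n - i\<close> turns the decreasing set of Erdos and
  Szekeres into an increasing set of the same size for the reversed function.\<close>

lemma lis_mult_lis_rev_fun:
  assumes "inj_on x {1..n}"
  shows "n \<le> lis x {1..n} * lis (rev_fun n x) {1..n}"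
proof -
  obtain S where S: "S \<subseteq> {1..n}" "strict_antimono_on S x" "card {1..n} \<le> lis x {1..n} * card S"
    using erdos_szekeres[OF _ assms] by auto
  have "strict_mono_on ((\<lambda>i. Suc n - i) ` S) (rev_fun n x)"
  proof (rule monotone_onI, clarsimp)
    fix i j assume ij: "i \<in> S" "j \<in> S" "Suc n - i < Suc n - j"
    then have b: "i \<in> {1..n}" "j \<in> {1..n}" using S(1) by auto
    have "j < i" using ij by auto
    then have "x i < x j" using S(2) ij by (auto simp: monotone_on_def)
    moreover have "Suc n - i \<in> {1..n}" "Suc n - (Suc n - i) = i"
      "Suc n - j \<in> {1..n}" "Suc n - (Suc n - j) = j" using b by auto
    ultimately show "rev_fun n x (Suc n - i) < rev_fun n x (Suc n - j)"
      by (simp add: rev_fun_def)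
  qed
  moreover have "(\<lambda>i. Suc n - i) ` S \<subseteq> {1..n}" using S(1) by force
  moreover have "card ((\<lambda>i. Suc n - i) ` S) = card S"
    by (rule card_image) (use S(1) in \<open>force simp: inj_on_def\<close>)
  ultimately have "card S \<le> lis (rev_fun n x) {1..n}"
    using card_le_lis[of "{1..n}" "(\<lambda>i. Suc n - i) ` S" "rev_fun n x"] by simp
  then have "lis x {1..n} * card S \<le> lis x {1..n} * lis (rev_fun n x) {1..n}"
    by (rule mult_le_mono2)
  with S(3) show ?thesis by (metis card_atLeastAtMost diff_Suc_1 le_trans)
qed

subsection \<open>Uniform injections\<close>

text \<open>Extensionality makes each injection on \<open>{1..n}\<close> have a single
  representative, so cardinalities count correctly.\<close>

definition injections :: "nat \<Rightarrow> nat \<Rightarrow> (nat \<Rightarrow> nat) set" where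
  "injections k n = {x \<in> {1..n} \<rightarrow>\<^sub>E {1..k}. inj_on x {1..n}}"

lemma finite_injections: "finite (injections k n)"
  unfolding injections_def by (simp add: finite_PiE)

lemma card_injections: "card (injections k n) = (\<Prod>i<n. k - i)"
  unfolding injections_def using card_inj_on_subset_funcset[of "{1..n}" "{1..k}" "{1..n}"]
  by (simp add: atLeast0LessThan)

lemma card_injections_pos: "n \<le> k \<Longrightarrow> card (injections k n) > 0"
  by (auto simp: card_injections)

lemma rev_fun_rev_fun: "x \<in> injections k n \<Longrightarrow> rev_fun n (rev_fun n x) = x"
  by (rule extensionalityI[of _ "{1..n}"]) (auto simp: rev_fun_def injections_def PiE_def)

lemma rev_fun_in_injections:
  assumes "x \<in> injections k n" shows "rev_fun n x \<in> injections k n"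
proof -
  have "x \<in> {1..n} \<rightarrow> {1..k}" "inj_on x {1..n}" using assms by (auto simp: injections_def)
  moreover have "inj_on (\<lambda>i. x (Suc n - i)) {1..n}"
  proof (rule inj_onI)
    fix i j assume a: "i \<in> {1..n}" "j \<in> {1..n}" "x (Suc n - i) = x (Suc n - j)"
    have "Suc n - i = Suc n - j" by (rule inj_onD[OF calculation(2) a(3)]) (use a in auto)
    then show "i = j" using a by auto
  qed
  moreover have "Suc n - i \<in> {1..n}" if "i \<in> {1..n}" for i using that by auto
  ultimately show ?thesis
    by (simp add: injections_def rev_fun_def inj_on_restrict_eq Pi_iff)
qed

lemma bij_betw_rev_fun: "bij_betw (rev_fun n) (injections k n) (injections k n)"
  by (rule bij_betw_byWitness[where f' = "rev_fun n"])
     (auto simp: rev_fun_rev_fun rev_fun_in_injections)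

text \<open>Two lengths with product at least \<open>n\<close> have sum at least
  \<open>2 * sqrt n\<close>, by the arithmetic-geometric mean inequality. Reversal permutes the
  injections, so both lengths have the same total.\<close>

lemma sum_lis_injections_ge:
  "sqrt n * card (injections k n) \<le> (\<Sum>x\<in>injections k n. real (lis x {1..n}))"
proof -
  have "2 * sqrt n \<le> real (lis x {1..n}) + real (lis (rev_fun n x) {1..n})"
    if "x \<in> injections k n" for x
  proof -
    have "real n \<le> real (lis x {1..n}) * real (lis (rev_fun n x) {1..n})"
      using lis_mult_lis_rev_fun[of x n] that
      unfolding of_nat_mult[symmetric] of_nat_le_iff by (simp add: injections_def)
    then have "sqrt n \<le> sqrt (real (lis x {1..n}) * real (lis (rev_fun n x) {1..n}))"
      by (rule real_sqrt_le_mono)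
    also have "\<dots> \<le> (real (lis x {1..n}) + real (lis (rev_fun n x) {1..n})) / 2"
      by (rule arith_geo_mean_sqrt) auto
    finally show ?thesis by simp
  qed
  then have "(\<Sum>x\<in>injections k n. 2 * sqrt n) \<le>
    (\<Sum>x\<in>injections k n. real (lis x {1..n}) + real (lis (rev_fun n x) {1..n}))"
    by (rule sum_mono)
  also have "\<dots> = 2 * (\<Sum>x\<in>injections k n. real (lis x {1..n}))"
    using sum.reindex_bij_betw[OF bij_betw_rev_fun, of "\<lambda>x. real (lis x {1..n})" n k]
    by (simp add: sum.distrib)
  finally show ?thesis by (simp add: mult.commute)
qed

text \<open>
  The symmetric group on \<open>S\<close> acts freely on injections by permuting the values on \<open>S\<close>, and each
  orbit contains exactly one injection increasing on \<open>S\<close>.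
\<close>

lemma card_increasing_on_le:
  assumes S: "S \<subseteq> {1..n}"
  shows "fact (card S) * card {x \<in> injections k n. strict_mono_on S x} \<le> card (injections k n)"
proof -
  define A where "A = {x \<in> injections k n. strict_mono_on S x}"
  have fS: "finite S" using S finite_subset by blast
  have "inj_on (\<lambda>(p, x). x \<circ> p) ({p. p permutes S} \<times> A)"
  proof (rule inj_onI, clarsimp)
    fix p x q y assume p: "p permutes S" and q: "q permutes S" and x: "x \<in> A" and y: "y \<in> A"
      and eq: "x \<circ> p = y \<circ> q"
    have im: "x ` S = y ` S"
      using eq permutes_image[OF p] permutes_image[OF q] by (metis image_comp)
    have mx: "strict_mono_on S x" and my: "strict_mono_on S y"
      using x y by (auto simp: A_def)
    \<comment> \<open>An increasing function on \<open>S\<close> is determined by its image: its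
      value at \<open>i\<close> has as many smaller elements in the image as \<open>i\<close> has
      predecessors in \<open>S\<close>.\<close>
    have card_below: "card {v \<in> z ` S. v < z i} = card {j \<in> S. j < i}"
      if z: "strict_mono_on S z" and i: "i \<in> S" for z :: "nat \<Rightarrow> nat" and i
    proof -
      have "{v \<in> z ` S. v < z i} = z ` {j \<in> S. j < i}"
        using strict_mono_on_less[OF z _ i] by auto
      moreover have "inj_on z {j \<in> S. j < i}"
        by (rule inj_on_subset[OF strict_mono_on_imp_inj_on[OF z]]) auto
      ultimately show ?thesis by (simp add: card_image)
    qed
    have xy: "x i = y i" for i
    proof (cases "i \<in> S")
      case True
      have c: "card {v \<in> x ` S. v < x i} = card {v \<in> x ` S. v < y i}"
        using card_below[OF mx True] card_below[OF my True] im by simp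
      have lt: "card {v \<in> x ` S. v < u} < card {v \<in> x ` S. v < w}" if "u < w" "u \<in> x ` S" for u w
        by (rule psubset_card_mono) (use that fS in auto)
      have "x i \<in> x ` S" "y i \<in> x ` S" using True im by auto
      then show ?thesis using lt[of "x i" "y i"] lt[of "y i" "x i"] c by (metis nat_neq_iff)
    next
      case False
      then show ?thesis
        using eq permutes_not_in[OF p False] permutes_not_in[OF q False] by (metis comp_apply)
    qed
    then have "x = y" by auto
    moreover have "p i = q i" for i
    proof (cases "i \<in> S")
      case True
      have "x (p i) = x (q i)" using eq \<open>x = y\<close> by (metis comp_apply)
      then show ?thesis
        using inj_onD[OF strict_mono_on_imp_inj_on[OF mx]] True
          permutes_in_image[OF p] permutes_in_image[OF q] by metis
    next
      case False
      then show ?thesis using permutes_not_in[OF p] permutes_not_in[OF q] by metis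
    qed
    ultimately show "p = q \<and> x = y" by auto
  qed
  moreover have "(\<lambda>(p, x). x \<circ> p) ` ({p. p permutes S} \<times> A) \<subseteq> injections k n"
  proof clarsimp
    fix p x assume p: "p permutes S" and "x \<in> A"
    then have x: "x \<in> {1..n} \<rightarrow>\<^sub>E {1..k}" "inj_on x {1..n}" by (auto simp: A_def injections_def)
    \<comment> \<open>A permutation of \<open>S\<close> fixes all points outside \<open>S\<close>,
      so it also permutes \<open>{1..n}\<close> and the composite stays extensional.\<close>
    have p': "p permutes {1..n}" using permutes_subset[OF p S] .
    have "inj_on (x \<circ> p) {1..n}"
      using comp_inj_on[OF permutes_inj_on[OF p', of "{1..n}"], of x] x(2) permutes_image[OF p'] by simp
    moreover have "x \<circ> p \<in> {1..n} \<rightarrow>\<^sub>E {1..k}"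
      using x(1) permutes_in_image[OF p'] permutes_not_in[OF p'] by (auto simp: PiE_iff extensional_def)
    ultimately show "x \<circ> p \<in> injections k n" by (simp add: injections_def)
  qed
  ultimately have "card ({p. p permutes S} \<times> A) \<le> card (injections k n)"
    using card_inj_on_le finite_injections by blast
  then show ?thesis by (simp add: card_cartesian_product card_permutations[OF refl fS] A_def)
qed

text \<open>Union bound: a length of at least \<open>t\<close> yields an increasing set of exactly
  \<open>t\<close> positions, and each of the \<open>n choose t\<close> candidates is increasing for
  at most a fraction \<open>1 / fact t\<close> of the injections.\<close>

lemma card_lis_ge_le:
  "fact t * card {x \<in> injections k n. t \<le> lis x {1..n}} \<le> (n choose t) * card (injections k n)"
proof -
  let ?F = "{S. S \<subseteq> {1..n} \<and> card S = t}"
  have "{x \<in> injections k n. t \<le> lis x {1..n}} \<subseteq> (\<Union>S\<in>?F. {x \<in> injections k n. strict_mono_on S x})"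
  proof clarsimp
    fix x assume "x \<in> injections k n" and t: "t \<le> lis x {Suc 0..n}"
    obtain S where S: "S \<subseteq> {1..n}" "strict_mono_on S x" "card S = lis x {1..n}"
      by (rule lis_witness[of "{1..n}" x]) auto
    obtain S' where "S' \<subseteq> S" "card S' = t" using obtain_subset_with_card_n[of t S] S t by auto
    then show "\<exists>S. S \<subseteq> {Suc 0..n} \<and> card S = t \<and> strict_mono_on S x"
      using S monotone_on_subset[OF S(2)] by auto
  qed
  then have "card {x \<in> injections k n. t \<le> lis x {1..n}}
      \<le> card (\<Union>S\<in>?F. {x \<in> injections k n. strict_mono_on S x})"
    by (intro card_mono finite_UN_I) (auto simp: finite_injections)
  also have "\<dots> \<le> (\<Sum>S\<in>?F. card {x \<in> injections k n. strict_mono_on S x})"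
    by (intro card_UN_le) simp
  finally have "fact t * card {x \<in> injections k n. t \<le> lis x {1..n}}
      \<le> (\<Sum>S\<in>?F. fact t * card {x \<in> injections k n. strict_mono_on S x})"
    by (simp flip: sum_distrib_left)
  also have "\<dots> \<le> (\<Sum>S\<in>?F. card (injections k n))"
    by (intro sum_mono) (use card_increasing_on_le[of _ n k] in auto)
  also have "\<dots> = (n choose t) * card (injections k n)"
    using n_subsets[of "{1..n}" t] by simp
  finally show ?thesis .
qed

subsection \<open>Matching graphs as injections\<close>

definition graph_of :: "nat \<Rightarrow> (nat \<Rightarrow> nat) \<Rightarrow> bigraph" where
  "graph_of n x = (\<lambda>i. (i, x i)) ` {1..n}"

lemma mem_graph_of_iff: "(i, j) \<in> graph_of n x \<longleftrightarrow> i \<in> {1..n} \<and> j = x i"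
  by (auto simp: graph_of_def)

text \<open>Exactly one neighbour per bottom vertex makes the edge set the graph of a function; at
  most one neighbour per top vertex makes that function injective.\<close>

lemma bij_betw_graph_of: "bij_betw (graph_of n) (injections k n) (matching_graphs k n)"
proof -
  have "inj_on (graph_of n) (injections k n)"
  proof (rule inj_onI)
    fix x y assume x: "x \<in> injections k n" and y: "y \<in> injections k n"
      and eq: "graph_of n x = graph_of n y"
    have "x i = y i" if "i \<in> {1..n}" for i
    proof -
      from that have "(i, x i) \<in> graph_of n x" by (simp add: mem_graph_of_iff)
      then have "(i, x i) \<in> graph_of n y" by (simp only: eq)
      then show ?thesis by (simp add: mem_graph_of_iff)
    qed
    then show "x = y" using x y by (intro PiE_ext[of x "{1..n}" "\<lambda>_. {1..k}"]) (auto simp: injections_def)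
  qed
  moreover have "graph_of n x \<in> matching_graphs k n" if "x \<in> injections k n" for x
  proof -
    have x: "x i \<in> {1..k}" if "i \<in> {1..n}" for i
      using \<open>x \<in> _\<close> that by (auto simp: injections_def)
    have "graph_of n x \<subseteq> {1..n} \<times> {1..k}"
      unfolding graph_of_def by (intro image_subsetI SigmaI x)
    moreover have "\<forall>j\<in>{1..k}. \<forall>i i'. (i, j) \<in> graph_of n x \<longrightarrow> (i', j) \<in> graph_of n x \<longrightarrow> i = i'"
    proof (intro ballI allI impI)
      fix j i i' assume "(i, j) \<in> graph_of n x" "(i', j) \<in> graph_of n x"
      then have "i \<in> {1..n}" "i' \<in> {1..n}" "x i = x i'" unfolding mem_graph_of_iff by simp_all
      moreover have "inj_on x {1..n}" using \<open>x \<in> _\<close> by (simp add: injections_def)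
      ultimately show "i = i'" by (simp only: inj_on_eq_iff)
    qed
    moreover have "\<forall>i\<in>{1..n}. \<exists>!j. (i, j) \<in> graph_of n x"
      by (simp add: mem_graph_of_iff)
    ultimately show ?thesis
      unfolding matching_graphs_def complete_bigraph_def by (intro CollectI conjI)
  qed
  moreover have "\<exists>x\<in>injections k n. graph_of n x = G" if "G \<in> matching_graphs k n" for G
  proof -
    have G': "G \<subseteq> {1..n} \<times> {1..k} \<and> (\<forall>i\<in>{1..n}. \<exists>!j. (i, j) \<in> G) \<and>
        (\<forall>j\<in>{1..k}. \<forall>i i'. (i, j) \<in> G \<longrightarrow> (i', j) \<in> G \<longrightarrow> i = i')"
      using that unfolding matching_graphs_def complete_bigraph_def by (rule CollectD)
    note G = conjunct1[OF G'] bspec[OF conjunct1[OF conjunct2[OF G']]]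
      bspec[OF conjunct2[OF conjunct2[OF G']], rule_format]
    define x where "x = restrict (\<lambda>i. THE j. (i, j) \<in> G) {1..n}"
    have x: "(i, x i) \<in> G" if "i \<in> {1..n}" for i
      using theI'[OF G(2)[OF that]] that by (simp add: x_def)
    have gr: "graph_of n x = G"
    proof (intro equalityI subsetI; clarify)
      fix i j assume "(i, j) \<in> graph_of n x"
      then show "(i, j) \<in> G" using x by (auto simp: mem_graph_of_iff)
    next
      fix i j assume ij: "(i, j) \<in> G"
      then have "i \<in> {1..n}" using G(1) by blast
      then show "(i, j) \<in> graph_of n x"
        using the1_equality[OF G(2) ij] by (simp add: mem_graph_of_iff x_def)
    qed
    have "inj_on x {1..n}"
    proof (rule inj_onI)
      fix i i' assume i: "i \<in> {1..n}" "i' \<in> {1..n}" "x i = x i'"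
      then have "(i, x i) \<in> G" "(i', x i) \<in> G" using x[of i] x[of i'] by simp_all
      moreover from this have "x i \<in> {1..k}" using G(1) by blast
      ultimately show "i = i'" using G(3) by simp
    qed
    moreover have "x \<in> {1..n} \<rightarrow>\<^sub>E {1..k}"
    proof (rule PiE_I)
      show "x i \<in> {1..k}" if "i \<in> {1..n}" for i using x[OF that] G(1) by blast
    qed (auto simp: x_def)
    ultimately show ?thesis using gr by (auto simp: injections_def)
  qed
  ultimately show ?thesis by (intro bij_betw_imageI) blast+
qed

text \<open>A planar matching is determined by its bottom endpoints, on which \<open>x\<close> is
  increasing; conversely, listing an increasing set of positions in order gives a planar
  matching.\<close>

lemma planar_matching_graph_of_iff:
  "(\<exists>M. planar_matching (graph_of n x) t M) \<longleftrightarrow> (\<exists>S\<subseteq>{1..n}. strict_mono_on S x \<and> card S = t)"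
proof
  assume "\<exists>M. planar_matching (graph_of n x) t M"
  then obtain i j :: "nat \<Rightarrow> nat" where i: "strict_mono_on {1..t} i" and j: "strict_mono_on {1..t} j"
    and sub: "(\<lambda>s. (i s, j s)) ` {1..t} \<subseteq> graph_of n x"
    unfolding planar_matching_def by blast
  have ij: "i s \<in> {1..n}" "j s = x (i s)" if "s \<in> {1..t}" for s
    using sub that mem_graph_of_iff by blast+
  have "strict_mono_on (i ` {1..t}) x"
  proof (rule monotone_onI, clarify)
    fix r s assume "r \<in> {1..t}" "s \<in> {1..t}" "i r < i s"
    then show "x (i r) < x (i s)"
      using ij(2) strict_mono_on_less[OF i] strict_mono_onD[OF j] by metis
  qed
  moreover have "card (i ` {1..t}) = t"
    using card_image[OF strict_mono_on_imp_inj_on[OF i]] by simp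
  moreover have "i ` {1..t} \<subseteq> {1..n}" using ij by auto
  ultimately show "\<exists>S\<subseteq>{1..n}. strict_mono_on S x \<and> card S = t" by blast
next
  assume "\<exists>S\<subseteq>{1..n}. strict_mono_on S x \<and> card S = t"
  then obtain S where S: "S \<subseteq> {1..n}" "strict_mono_on S x" "card S = t" by blast
  then have "finite S" using finite_subset by blast
  then obtain h where h: "bij_betw h {..<t} S" "strict_mono_on {..<t} h"
    using ex_bij_betw_strict_mono_card S(3) by metis
  \<comment> \<open>\<open>h\<close> enumerates \<open>S\<close> from 0, while planar matchings are
    indexed from 1.\<close>
  have hS: "h (s - 1) \<in> S" if "s \<in> {1..t}" for s
    using bij_betwE[OF h(1)] that by auto
  have "strict_mono_on {1..t} (\<lambda>s. h (s - 1))"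
    by (rule monotone_onI) (auto intro!: strict_mono_onD[OF h(2)])
  moreover from this have "strict_mono_on {1..t} (\<lambda>s. x (h (s - 1)))"
    using hS S(2) unfolding monotone_on_def by blast
  moreover have "(\<lambda>s. (h (s - 1), x (h (s - 1)))) ` {1..t} \<subseteq> graph_of n x"
    using hS S(1) mem_graph_of_iff by blast
  ultimately show "\<exists>M. planar_matching (graph_of n x) t M"
    unfolding planar_matching_def by blast
qed

lemma max_planar_matching_graph_of: "max_planar_matching (graph_of n x) = lis x {1..n}"
proof -
  have "{t. \<exists>M. planar_matching (graph_of n x) t M} = card ` {S. S \<subseteq> {1..n} \<and> strict_mono_on S x}"
    by (auto simp: planar_matching_graph_of_iff)
  then show ?thesis by (simp add: max_planar_matching_def lis_def)
qed

section \<open>Transfer of means and probabilities to injections\<close>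

lemma expectation_random_matching_graph:
  assumes "n \<le> k"
  shows "measure_pmf.expectation (random_matching_graph k n) (\<lambda>G. real (max_planar_matching G)) =
    (\<Sum>x\<in>injections k n. real (lis x {1..n})) / card (injections k n)"
  using sum.reindex_bij_betw[OF bij_betw_graph_of, of "\<lambda>G. real (max_planar_matching G)" n k]
    bij_betw_same_card[OF bij_betw_graph_of, of k n]
  by (simp add: random_matching_graph_def max_planar_matching_graph_of
      integral_pmf_of_set finite_matching_graphs matching_graphs_nonempty assms)

lemma prob_random_matching_graph:
  assumes "n \<le> k"
  shows "measure_pmf.prob (random_matching_graph k n) {G. P (max_planar_matching G)} =
    real (card {x \<in> injections k n. P (lis x {1..n})}) / card (injections k n)"
proof -
  have "bij_betw (graph_of n) {x \<in> injections k n. P (lis x {1..n})}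
     (matching_graphs k n \<inter> {G. P (max_planar_matching G)})"
  proof (rule bij_betw_imageI)
    show "inj_on (graph_of n) {x \<in> injections k n. P (lis x {1..n})}"
      by (rule inj_on_subset[OF bij_betw_imp_inj_on[OF bij_betw_graph_of]]) auto
    have "graph_of n ` {x \<in> injections k n. P (max_planar_matching (graph_of n x))} =
      graph_of n ` injections k n \<inter> {G. P (max_planar_matching G)}" by blast
    then show "graph_of n ` {x \<in> injections k n. P (lis x {1..n})} =
      matching_graphs k n \<inter> {G. P (max_planar_matching G)}"
      by (simp only: bij_betw_imp_surj_on[OF bij_betw_graph_of] max_planar_matching_graph_of)
  qed
  then have "card {x \<in> injections k n. P (lis x {1..n})} =
      card (matching_graphs k n \<inter> {G. P (max_planar_matching G)})"
    by (rule bij_betw_same_card)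
  then show ?thesis
    unfolding random_matching_graph_def
      measure_pmf_of_set[OF matching_graphs_nonempty[OF assms] finite_matching_graphs]
    by (simp only: bij_betw_same_card[OF bij_betw_graph_of])
qed

section \<open>Independence of the length distribution from the number of top vertices\<close>

lemma card_injections_onto_eq:
  fixes A B :: "nat set"
  assumes fin: "finite A" "finite B" and card: "card A = card B"
  shows "card {x \<in> {1..n} \<rightarrow>\<^sub>E A. bij_betw x {1..n} A \<and> P (lis x {1..n})} =
    card {x \<in> {1..n} \<rightarrow>\<^sub>E B. bij_betw x {1..n} B \<and> P (lis x {1..n})}"
proof -
  \<comment> \<open>The two value sets play symmetric roles, so one inequality for all pairs
    suffices.\<close>
  have le: "card {x \<in> {1..n} \<rightarrow>\<^sub>E A. bij_betw x {1..n} A \<and> P (lis x {1..n})} \<le>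
    card {x \<in> {1..n} \<rightarrow>\<^sub>E B. bij_betw x {1..n} B \<and> P (lis x {1..n})}"
    if fin: "finite A" "finite B" and card: "card A = card B" for A B :: "nat set"
  proof -
    obtain f where f: "bij_betw f {..<card A} A" "strict_mono_on {..<card A} f"
      by (rule ex_bij_betw_strict_mono_card[OF fin(1)])
    obtain g where g: "bij_betw g {..<card A} B" "strict_mono_on {..<card A} g"
      using ex_bij_betw_strict_mono_card[OF fin(2)] card by metis
    \<comment> \<open>The order isomorphism from \<open>A\<close> to \<open>B\<close>, matching
      elements of equal rank; composing with it preserves which sets of positions are
      increasing.\<close>
    define h where "h = g \<circ> the_inv_into {..<card A} f"
    have h: "bij_betw h A B"
      unfolding h_def using bij_betw_trans[OF bij_betw_the_inv_into[OF f(1)] g(1)] .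
    have hm: "strict_mono_on A h"
    proof (rule monotone_onI)
      fix a b assume ab: "a \<in> A" "b \<in> A" "a < b"
      obtain s t where st: "s \<in> {..<card A}" "t \<in> {..<card A}" "a = f s" "b = f t"
        using ab f(1) unfolding bij_betw_def by blast
      have "s < t" using ab st strict_mono_on_less[OF f(2) st(1,2)] by simp
      moreover have "h a = g s" "h b = g t"
        using st the_inv_into_f_f[OF bij_betw_imp_inj_on[OF f(1)]] by (auto simp: h_def)
      ultimately show "h a < h b" using strict_mono_onD[OF g(2)] st by auto
    qed
    let ?\<Phi> = "\<lambda>x. restrict (\<lambda>i. h (x i)) {1..n}"
    have lis_eq: "lis (?\<Phi> x) {1..n} = lis x {1..n}" if "bij_betw x {1..n} A" for x
    proof -
      have "lis (?\<Phi> x) {1..n} = lis (\<lambda>i. h (x i)) {1..n}" by (rule lis_cong) auto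
      also have "\<dots> = lis x {1..n}"
        by (rule lis_comp_strict_mono) (use that hm in \<open>auto simp: bij_betw_def\<close>)
      finally show ?thesis .
    qed
    show ?thesis
    proof (rule card_inj_on_le[where f = ?\<Phi>])
      show "inj_on ?\<Phi> {x \<in> {1..n} \<rightarrow>\<^sub>E A. bij_betw x {1..n} A \<and> P (lis x {1..n})}"
      proof (rule inj_onI, clarify)
        fix x y assume x: "x \<in> {1..n} \<rightarrow>\<^sub>E A" and y: "y \<in> {1..n} \<rightarrow>\<^sub>E A" and eq: "?\<Phi> x = ?\<Phi> y"
        have "h (x i) = h (y i)" if "i \<in> {1..n}" for i
          using fun_cong[OF eq, of i] that by simp
        then have "x i = y i" if "i \<in> {1..n}" for i
          using inj_onD[OF bij_betw_imp_inj_on[OF h]] x y that by blast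
        then show "x = y" using x y by (intro PiE_ext[of x "{1..n}" "\<lambda>_. A"]) auto
      qed
      show "?\<Phi> ` {x \<in> {1..n} \<rightarrow>\<^sub>E A. bij_betw x {1..n} A \<and> P (lis x {1..n})}
        \<subseteq> {x \<in> {1..n} \<rightarrow>\<^sub>E B. bij_betw x {1..n} B \<and> P (lis x {1..n})}"
      proof (clarify, intro CollectI conjI)
        fix x assume x: "x \<in> {1..n} \<rightarrow>\<^sub>E A" "bij_betw x {1..n} A" "P (lis x {1..n})"
        have "bij_betw (\<lambda>i. h (x i)) {1..n} B"
          using bij_betw_trans[OF x(2) h] by (simp add: comp_def)
        then show "bij_betw (?\<Phi> x) {1..n} B"
          by (rule bij_betw_cong[THEN iffD1, rotated]) auto
        then show "?\<Phi> x \<in> {1..n} \<rightarrow>\<^sub>E B"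
          by (auto simp: bij_betw_def)
        show "P (lis (?\<Phi> x) {1..n})" using lis_eq[OF x(2)] x(3) by simp
      qed
      show "finite {x \<in> {1..n} \<rightarrow>\<^sub>E B. bij_betw x {1..n} B \<and> P (lis x {1..n})}"
        using fin by (simp add: finite_PiE)
    qed
  qed
  show ?thesis using le[OF fin card] le[OF fin(2,1) card[symmetric]] by simp
qed

text \<open>Injections are classified by their image. By order isomorphism every
  \<open>n\<close>-element image contributes as much as \<open>{1..n}\<close> does.\<close>

lemma card_injections_lis:
  "card {x \<in> injections k n. P (lis x {1..n})} =
    (k choose n) * card {x \<in> injections n n. P (lis x {1..n})}"
proof -
  define J where "J A = {x \<in> {1..n} \<rightarrow>\<^sub>E A. bij_betw x {1..n} A \<and> P (lis x {1..n})}" for A :: "nat set"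
  let ?F = "{A. A \<subseteq> {1..k} \<and> card A = n}"
  have "{x \<in> injections k n. P (lis x {1..n})} = (\<Union>A\<in>?F. J A)"
  proof (intro equalityI subsetI)
    fix x assume x: "x \<in> {x \<in> injections k n. P (lis x {1..n})}"
    then have x: "x \<in> {1..n} \<rightarrow>\<^sub>E {1..k}" "inj_on x {1..n}" "P (lis x {1..n})"
      by (auto simp: injections_def)
    have "x ` {1..n} \<subseteq> {1..k}" using x(1) by blast
    moreover have "card (x ` {1..n}) = n" using card_image[OF x(2)] by simp
    moreover have "x \<in> {1..n} \<rightarrow>\<^sub>E x ` {1..n}" using x(1) by (simp add: PiE_iff)
    ultimately have "x ` {1..n} \<in> ?F" "x \<in> J (x ` {1..n})"
      using x(2,3) by (simp_all add: J_def bij_betw_def)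
    then show "x \<in> (\<Union>A\<in>?F. J A)" by blast
  next
    fix x assume "x \<in> (\<Union>A\<in>?F. J A)"
    then obtain A where "A \<subseteq> {1..k}" "x \<in> {1..n} \<rightarrow>\<^sub>E A" "inj_on x {1..n}" "P (lis x {1..n})"
      by (auto simp: J_def bij_betw_def)
    moreover from this have "x \<in> {1..n} \<rightarrow>\<^sub>E {1..k}" using PiE_mono by blast
    ultimately show "x \<in> {x \<in> injections k n. P (lis x {1..n})}"
      by (simp add: injections_def)
  qed
  moreover have "card (\<Union>A\<in>?F. J A) = (\<Sum>A\<in>?F. card (J A))"
  proof (rule card_UN_disjoint)
    show "\<forall>A\<in>?F. finite (J A)"
    proof
      fix A assume "A \<in> ?F"
      then have "finite ({1..n} \<rightarrow>\<^sub>E A)" by (intro finite_PiE) (auto dest: finite_subset)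
      then show "finite (J A)" by (simp add: J_def)
    qed
    show "\<forall>A\<in>?F. \<forall>B\<in>?F. A \<noteq> B \<longrightarrow> J A \<inter> J B = {}"
      unfolding J_def bij_betw_def by blast
  qed auto
  moreover have "(\<Sum>A\<in>?F. card (J A)) = (\<Sum>A\<in>?F. card (J {1..n}))"
    unfolding J_def by (intro sum.cong refl card_injections_onto_eq) (auto dest: finite_subset)
  \<comment> \<open>An injective self-map of a finite set is onto, so the class with image
    \<open>{1..n}\<close> consists of all of \<open>injections n n\<close>.\<close>
  moreover have "bij_betw x {1..n} {1..n} \<longleftrightarrow> inj_on x {1..n}" if "x \<in> {1..n} \<rightarrow>\<^sub>E {1..n}" for x
    using endo_inj_surj[of "{1..n}" x] that unfolding bij_betw_def by blast
  then have "J {1..n} = {x \<in> injections n n. P (lis x {1..n})}"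
    unfolding J_def injections_def by blast
  ultimately show ?thesis using n_subsets[of "{1..k}" n] by simp
qed

text \<open>The binomial factor cancels against the total count, which is the case of the constantly
  true predicate. This permits replacing \<open>k\<close> by a conveniently large number of
  values.\<close>

lemma injections_lis_frequency_eq:
  assumes "n \<le> k" "n \<le> N"
  shows "real (card {x \<in> injections k n. P (lis x {1..n})}) / card (injections k n) =
    real (card {x \<in> injections N n. P (lis x {1..n})}) / card (injections N n)"
proof -
  have "real (card {x \<in> injections k n. P (lis x {1..n})}) / card (injections k n) =
    real (card {x \<in> injections n n. P (lis x {1..n})}) / card (injections n n)" if "n \<le> k" for k
    using that card_injections_lis[of k n P] card_injections_lis[of k n "\<lambda>_. True"] by simp
  from this[OF assms(1)] this[OF assms(2)] show ?thesis by (rule trans[OF _ sym])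
qed

subsection \<open>The Efron-Stein inequality and the lower tail\<close>

definition avg :: "'a set \<Rightarrow> ('a \<Rightarrow> real) \<Rightarrow> real" where
  "avg S f = (\<Sum>x\<in>S. f x) / card S"

text \<open>For empty or infinite \<open>S\<close> the sum and the cardinality both default to
  0.\<close>

lemma sum_eq_card_mult_avg: "(\<Sum>x\<in>S. f x) = card S * avg S f"
  by (cases "finite S \<and> S \<noteq> {}") (auto simp: avg_def)

text \<open>Deviations from the mean sum to zero, so the cross term vanishes. It serves twice: to
  split a variance along a coordinate, and to show that the mean is the best constant in least
  squares.\<close>

lemma sum_square_dev:
  "(\<Sum>x\<in>S. (f x - c)\<^sup>2) = (\<Sum>x\<in>S. (f x - avg S f)\<^sup>2) + card S * (avg S f - c)\<^sup>2"
proof -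
  have "(f x - c)\<^sup>2 = (f x - avg S f)\<^sup>2 + 2 * (avg S f - c) * f x
      + ((avg S f - c)\<^sup>2 - 2 * (avg S f - c) * avg S f)" for x
    by (simp add: power2_eq_square algebra_simps)
  then have "(\<Sum>x\<in>S. (f x - c)\<^sup>2) = (\<Sum>x\<in>S. (f x - avg S f)\<^sup>2)
      + 2 * (avg S f - c) * (\<Sum>x\<in>S. f x)
      + card S * ((avg S f - c)\<^sup>2 - 2 * (avg S f - c) * avg S f)"
    by (simp add: sum.distrib sum_distrib_left)
  then show ?thesis by (simp add: sum_eq_card_mult_avg algebra_simps)
qed

lemma sum_PiE_insert:
  assumes "i \<notin> I"
  shows "(\<Sum>x\<in>insert i I \<rightarrow>\<^sub>E A. h x) = (\<Sum>y\<in>I \<rightarrow>\<^sub>E A. \<Sum>a\<in>A. h (y(i := a)))"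
proof -
  have "(\<Sum>x\<in>insert i I \<rightarrow>\<^sub>E A. h x) = (\<Sum>(a, y)\<in>A \<times> (I \<rightarrow>\<^sub>E A). h (y(i := a)))"
    unfolding PiE_insert_eq
    by (subst sum.reindex[OF inj_combinator[OF assms]]) (simp add: case_prod_unfold)
  also have "\<dots> = (\<Sum>a\<in>A. \<Sum>y\<in>I \<rightarrow>\<^sub>E A. h (y(i := a)))"
    by (simp add: sum.cartesian_product)
  finally show ?thesis by (simp add: sum.swap[of _ A])
qed

text \<open>Stated with unnormalized sums, and with any \<open>g i\<close> that ignores coordinate
  \<open>i\<close> in place of the conditional mean. The induction splits off one coordinate at a
  time.\<close>

lemma efron_stein:
  fixes f :: "('i \<Rightarrow> 'a) \<Rightarrow> real"
  assumes "finite I" "finite A" "A \<noteq> {}"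
    and "\<And>i x a. i \<in> I \<Longrightarrow> x \<in> I \<rightarrow>\<^sub>E A \<Longrightarrow> a \<in> A \<Longrightarrow> g i (x(i := a)) = g i x"
  shows "(\<Sum>x\<in>I \<rightarrow>\<^sub>E A. (f x - avg (I \<rightarrow>\<^sub>E A) f)\<^sup>2) \<le> (\<Sum>i\<in>I. \<Sum>x\<in>I \<rightarrow>\<^sub>E A. (f x - g i x)\<^sup>2)"
  using assms(1,4)
proof (induction I arbitrary: f g rule: finite_induct)
  case empty
  then show ?case by (simp add: avg_def)
next
  case (insert i I)
  let ?P = "insert i I \<rightarrow>\<^sub>E A" and ?Q = "I \<rightarrow>\<^sub>E A"
  \<comment> \<open>\<open>m\<close> averages out coordinate \<open>i\<close>, and \<open>q\<close>
    averages out all the others; the average of \<open>q\<close> is the overall mean.\<close>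
  define m where "m y = avg A (\<lambda>a. f (y(i := a)))" for y
  define q where "q a = avg ?Q (\<lambda>y. f (y(i := a)))" for a
  have A: "card A > 0" using assms by (simp add: card_gt_0_iff)
  have Q: "finite ?Q" "?Q \<noteq> {}" using insert assms by (auto simp: finite_PiE PiE_eq_empty_iff)
  then have cQ: "card ?Q > 0" by (simp add: card_gt_0_iff)
  have upd: "y(i := a) \<in> ?P" if "y \<in> ?Q" "a \<in> A" for y a
    using that by (auto simp: PiE_iff extensional_def)
  have cP: "card ?P = card A * card ?Q"
    using insert by (simp add: card_PiE)
  have M: "avg ?P f = avg A q"
    using A cQ unfolding avg_def[of ?P] cP sum_PiE_insert[OF insert.hyps(2)]
    by (subst sum.swap) (simp add: q_def avg_def flip: sum_divide_distrib)
  have "(\<Sum>x\<in>?P. (f x - avg ?P f)\<^sup>2) = (\<Sum>y\<in>?Q. \<Sum>a\<in>A. (f (y(i := a)) - avg A q)\<^sup>2)"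
    by (simp add: sum_PiE_insert[OF insert.hyps(2)] M)
  \<comment> \<open>Squared deviations along coordinate \<open>i\<close> from the conditional mean,
    plus those of the conditional mean from the overall one.\<close>
  also have "\<dots> = (\<Sum>y\<in>?Q. \<Sum>a\<in>A. (f (y(i := a)) - m y)\<^sup>2) + (\<Sum>y\<in>?Q. card A * (m y - avg A q)\<^sup>2)"
    by (subst sum_square_dev) (simp add: m_def sum.distrib)
  also have "\<dots> \<le> (\<Sum>y\<in>?Q. \<Sum>a\<in>A. (f (y(i := a)) - g i (y(i := a)))\<^sup>2)
      + (\<Sum>y\<in>?Q. \<Sum>a\<in>A. (f (y(i := a)) - q a)\<^sup>2)"
  proof (rule add_mono; rule sum_mono)
    fix y assume y: "y \<in> ?Q"
    obtain b where b: "b \<in> A" using assms by auto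
    \<comment> \<open>Along coordinate \<open>i\<close> the function \<open>g i\<close> is a
      constant, and no constant beats the mean \<open>m y\<close>.\<close>
    have "g i (y(i := a)) = g i (y(i := b))" if "a \<in> A" for a
      using insert.prems[OF insertI1 upd[OF y b] that] by (simp only: fun_upd_upd)
    then have "(\<Sum>a\<in>A. (f (y(i := a)) - g i (y(i := b)))\<^sup>2) = (\<Sum>a\<in>A. (f (y(i := a)) - g i (y(i := a)))\<^sup>2)"
      by simp
    moreover have "(\<Sum>a\<in>A. (f (y(i := a)) - m y)\<^sup>2) \<le> (\<Sum>a\<in>A. (f (y(i := a)) - g i (y(i := b)))\<^sup>2)"
      unfolding sum_square_dev[of _ "g i (y(i := b))"] by (simp add: m_def)
    ultimately show "(\<Sum>a\<in>A. (f (y(i := a)) - m y)\<^sup>2) \<le> (\<Sum>a\<in>A. (f (y(i := a)) - g i (y(i := a)))\<^sup>2)"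
      by simp
  next
    fix y assume "y \<in> ?Q"
    \<comment> \<open>The deviation of \<open>m\<close> is an average over \<open>a\<close> of the
      deviations of the slices from their own means, so Cauchy-Schwarz bounds its square.\<close>
    have "m y - avg A q = (\<Sum>a\<in>A. f (y(i := a)) - q a) / card A"
      by (simp add: m_def avg_def sum_subtractf diff_divide_distrib)
    then have "card A * (m y - avg A q)\<^sup>2 = (\<Sum>a\<in>A. f (y(i := a)) - q a)\<^sup>2 / card A"
      using A by (simp add: power_divide power2_eq_square)
    also have "\<dots> \<le> (\<Sum>a\<in>A. (f (y(i := a)) - q a)\<^sup>2)"
      using sum_squared_le_sum_of_squares[of "\<lambda>a. f (y(i := a)) - q a" A] A
      by (simp add: divide_le_eq)
    finally show "card A * (m y - avg A q)\<^sup>2 \<le> (\<Sum>a\<in>A. (f (y(i := a)) - q a)\<^sup>2)" .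
  qed
  also have "(\<Sum>y\<in>?Q. \<Sum>a\<in>A. (f (y(i := a)) - q a)\<^sup>2) = (\<Sum>a\<in>A. \<Sum>y\<in>?Q. (f (y(i := a)) - q a)\<^sup>2)"
    by (rule sum.swap)
  also have "\<dots> \<le> (\<Sum>a\<in>A. \<Sum>j\<in>I. \<Sum>y\<in>?Q. (f (y(i := a)) - g j (y(i := a)))\<^sup>2)"
  proof (rule sum_mono)
    fix a assume a: "a \<in> A"
    \<comment> \<open>Slices at a fixed \<open>a\<close> inherit the independence assumption, so the
      induction hypothesis applies to each of them.\<close>
    have "g j ((y(j := b))(i := a)) = g j (y(i := a))" if "j \<in> I" "y \<in> ?Q" "b \<in> A" for j y b
    proof -
      have "j \<noteq> i" using that insert.hyps by auto
      then have "(y(j := b))(i := a) = (y(i := a))(j := b)" by (rule fun_upd_twist)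
      then show ?thesis
        using insert.prems[OF insertI2[OF that(1)] upd[OF that(2) a] that(3)] by (simp only:)
    qed
    then show "(\<Sum>y\<in>?Q. (f (y(i := a)) - q a)\<^sup>2) \<le> (\<Sum>j\<in>I. \<Sum>y\<in>?Q. (f (y(i := a)) - g j (y(i := a)))\<^sup>2)"
      unfolding q_def
      by (intro insert.IH[of "\<lambda>j y. g j (y(i := a))" "\<lambda>y. f (y(i := a))"])
  qed
  also have "(\<Sum>a\<in>A. \<Sum>j\<in>I. \<Sum>y\<in>?Q. (f (y(i := a)) - g j (y(i := a)))\<^sup>2) =
      (\<Sum>j\<in>I. \<Sum>x\<in>?P. (f x - g j x)\<^sup>2)"
    unfolding sum_PiE_insert[OF insert.hyps(2)]
    by (subst sum.swap, intro sum.cong refl) (rule sum.swap)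
  finally show ?case
    unfolding sum.insert[OF insert.hyps(1,2)] sum_PiE_insert[OF insert.hyps(2)]
    by (simp only: add_le_cancel_left)
qed

text \<open>
  Deleting one position changes the length by at most one, and changes it at all only if the
  position belongs to every longest increasing subsequence.
\<close>

lemma sum_lis_delete_le:
  assumes "finite I"
  shows "(\<Sum>i\<in>I. (real (lis x I) - real (lis x (I - {i})))\<^sup>2) \<le> real (lis x I)"
proof -
  obtain S where S: "S \<subseteq> I" "strict_mono_on S x" "card S = lis x I"
    by (rule lis_witness[OF assms])
  have "(real (lis x I) - real (lis x (I - {i})))\<^sup>2 \<le> (if i \<in> S then 1 else 0)" if "i \<in> I" for i
  proof -
    have le: "lis x (I - {i}) \<le> lis x I" by (rule lis_mono) (use assms in auto)
    have "card (S - {i}) \<le> lis x (I - {i})"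
      by (rule card_le_lis) (use assms S in \<open>auto intro: monotone_on_subset\<close>)
    then have "real (lis x I) - real (lis x (I - {i})) \<le> (if i \<in> S then 1 else 0)"
      using S by (auto simp: card_Diff_singleton_if split: if_splits)
    then show ?thesis using le by (auto simp: power_le_one)
  qed
  then have "(\<Sum>i\<in>I. (real (lis x I) - real (lis x (I - {i})))\<^sup>2) \<le> (\<Sum>i\<in>I. if i \<in> S then 1 else 0)"
    by (rule sum_mono)
  also have "\<dots> = real (card S)"
    using assms S(1) by (simp add: sum.If_cases Int_absorb1)
  finally show ?thesis using S(3) by simp
qed

text \<open>Efron-Stein with \<open>g i\<close> the length after deleting position \<open>i\<close>,
  which ignores the letter there. The squared losses of a word sum to at most its length, so the
  variance is at most the mean.\<close>

lemma lis_words_variance: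
  fixes n :: nat
  assumes "finite A" "A \<noteq> {}"
  defines "W \<equiv> {1..n} \<rightarrow>\<^sub>E A"
  shows "(\<Sum>x\<in>W. (real (lis x {1..n}) - avg W (\<lambda>x. real (lis x {1..n})))\<^sup>2)
    \<le> (\<Sum>x\<in>W. real (lis x {1..n}))"
proof -
  have "(\<Sum>x\<in>W. (real (lis x {1..n}) - avg W (\<lambda>x. real (lis x {1..n})))\<^sup>2)
      \<le> (\<Sum>i\<in>{1..n}. \<Sum>x\<in>W. (real (lis x {1..n}) - real (lis x ({1..n} - {i})))\<^sup>2)"
    unfolding W_def
    by (rule efron_stein[where g = "\<lambda>i x. real (lis x ({1..n} - {i}))"])
       (use assms in \<open>auto intro!: lis_cong\<close>)
  also have "\<dots> = (\<Sum>x\<in>W. \<Sum>i\<in>{1..n}. (real (lis x {1..n}) - real (lis x ({1..n} - {i})))\<^sup>2)"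
    by (rule sum.swap)
  also have "\<dots> \<le> (\<Sum>x\<in>W. real (lis x {1..n}))"
    by (intro sum_mono sum_lis_delete_le) simp
  finally show ?thesis .
qed

text \<open>Each factor of the falling factorial is at least \<open>N - n\<close>, and Bernoulli's
  inequality handles the power of \<open>1 - n / N\<close>.\<close>

lemma card_injections_ge:
  assumes "n \<le> N" "N > 0"
  shows "(1 - real n ^ 2 / N) * real N ^ n \<le> card (injections N n)"
proof -
  have "1 - real n ^ 2 / N = 1 + real n * (- (real n / N))" by (simp add: power2_eq_square)
  also have "\<dots> \<le> (1 + - (real n / N)) ^ n"
    using assms by (intro Bernoulli_inequality) simp
  finally have "(1 - real n ^ 2 / N) * real N ^ n \<le> (1 + - (real n / N)) ^ n * real N ^ n"
    by (intro mult_right_mono) auto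
  also have "\<dots> = (real N - real n) ^ n"
    using assms by (simp flip: power_mult_distrib add: field_simps)
  also have "\<dots> = (\<Prod>i<n. real N - real n)" by simp
  also have "\<dots> \<le> (\<Prod>i<n. real (N - i))"
    using assms by (intro prod_mono) auto
  finally show ?thesis by (simp add: card_injections)
qed

text \<open>
  Chebyshev's inequality for words over a large alphabet, almost all of which are injective.
\<close>

lemma lis_injections_lower_tail:
  assumes n: "1 \<le> n" and k: "n \<le> k"
  shows "real (card {x \<in> injections k n. real (lis x {1..n}) < 0.65 * sqrt n})
    / card (injections k n) \<le> 16 / sqrt n"
proof -
  \<comment> \<open>With this alphabet at least nine tenths of the words are injective.\<close>
  define N where "N = 10 * n\<^sup>2"
  define W where "W = {1..n} \<rightarrow>\<^sub>E {1..N}"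
  define \<mu> where "\<mu> = avg W (\<lambda>x. real (lis x {1..n}))"
  \<comment> \<open>The factor 0.65 exceeds \<open>1 - exp (-1)\<close>, hence covers
    \<open>mu_low\<close>, and stays below the 0.9 obtained for the mean, leaving a gap of
    \<open>sqrt n / 4\<close>.\<close>
  define s where "s = 0.65 * sqrt n"
  let ?J = "injections N n"
  have N: "n \<le> N" "N > 0" using n by (auto simp: N_def power2_eq_square)
  have cW: "real (card W) = real N ^ n" by (simp add: W_def card_PiE)
  then have W0: "real (card W) > 0" using N by simp
  have finW: "finite W" by (simp add: W_def finite_PiE)
  have eq: "1 - real n ^ 2 / N = 0.9" using n by (simp add: N_def field_simps)
  have J: "0.9 * real (card W) \<le> card ?J"
    using card_injections_ge[OF N] unfolding eq cW .
  have JW: "?J \<subseteq> W" by (auto simp: injections_def W_def)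
  have sq: "sqrt n > 0" using n by simp
  \<comment> \<open>The injective words alone give the words a mean of at least
    \<open>0.9 * sqrt n\<close>, the other lengths being nonnegative.\<close>
  have "0.9 * real (card W) * sqrt n \<le> sqrt n * card ?J"
    using mult_right_mono[OF J, of "sqrt n"] sq by (simp add: mult.commute)
  also have "\<dots> \<le> (\<Sum>x\<in>?J. real (lis x {1..n}))" by (rule sum_lis_injections_ge)
  also have "\<dots> \<le> (\<Sum>x\<in>W. real (lis x {1..n}))" by (intro sum_mono2 finW JW) auto
  also have "\<dots> = card W * \<mu>" by (simp add: \<mu>_def sum_eq_card_mult_avg)
  finally have \<mu>: "0.9 * sqrt n \<le> \<mu>" using W0 by (simp add: mult.assoc mult.left_commute)
  then have gap: "sqrt n / 4 \<le> \<mu> - s" by (simp add: s_def)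
  then have gap0: "0 < \<mu> - s" using sq by linarith
  have s0: "0 \<le> s" by (simp add: s_def)
  define B where "B = {x \<in> ?J. real (lis x {1..n}) < s}"
  have "card B * (\<mu> - s)\<^sup>2 = (\<Sum>x\<in>B. (\<mu> - s)\<^sup>2)" by simp
  also have "\<dots> \<le> (\<Sum>x\<in>B. (real (lis x {1..n}) - \<mu>)\<^sup>2)"
  proof (rule sum_mono)
    fix x assume "x \<in> B"
    then have "\<mu> - s \<le> \<mu> - real (lis x {1..n})" by (simp add: B_def)
    then have "(\<mu> - s)\<^sup>2 \<le> (\<mu> - real (lis x {1..n}))\<^sup>2" using gap0 by (intro power_mono) auto
    then show "(\<mu> - s)\<^sup>2 \<le> (real (lis x {1..n}) - \<mu>)\<^sup>2" by (simp add: power2_commute)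
  qed
  also have "\<dots> \<le> (\<Sum>x\<in>W. (real (lis x {1..n}) - \<mu>)\<^sup>2)"
    using JW by (intro sum_mono2 finW) (auto simp: B_def)
  also have "\<dots> \<le> (\<Sum>x\<in>W. real (lis x {1..n}))"
    using lis_words_variance[of "{1..N}" n] N by (simp add: \<mu>_def W_def)
  also have "\<dots> = card W * \<mu>" by (simp add: \<mu>_def sum_eq_card_mult_avg)
  finally have "card B \<le> card W * (\<mu> / (\<mu> - s)\<^sup>2)" using gap0 by (simp add: field_simps)
  \<comment> \<open>Split in this way, the bound decreases in the gap \<open>\<mu> - s\<close>, so
    the lower bound on the gap is enough. The constant is \<open>4 + 0.65 * 16 = 14.4\<close>, and
    \<open>14.4 / 0.9 = 16\<close>.\<close>
  also have "\<mu> / (\<mu> - s)\<^sup>2 = ((\<mu> - s) + s) / (\<mu> - s)\<^sup>2" by simp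
  also have "\<dots> = 1 / (\<mu> - s) + s / (\<mu> - s)\<^sup>2"
    unfolding add_divide_distrib by (simp add: power2_eq_square)
  also have "\<dots> \<le> 1 / (sqrt n / 4) + s / (sqrt n / 4)\<^sup>2"
    by (intro add_mono divide_left_mono power_mono mult_pos_pos zero_less_power)
       (use gap gap0 sq s0 in linarith)+
  also have "\<dots> = 14.4 / sqrt n"
    using sq by (simp add: s_def power2_eq_square field_simps)
  finally have "card B \<le> card W * (14.4 / sqrt n)" using W0 by (simp add: mult_left_mono)
  also have "\<dots> \<le> (card ?J / 0.9) * (14.4 / sqrt n)"
    using J sq by (intro mult_right_mono) auto
  finally have "card B / card ?J \<le> 16 / sqrt n"
    using card_injections_pos[OF N(1)] by (simp add: divide_le_eq)
  then show ?thesis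
    using injections_lis_frequency_eq[OF k N(1), of "\<lambda>l. real l < s"] by (simp add: B_def s_def)
qed

subsection \<open>The upper tail and its consequences\<close>

lemma exp_two: "exp 2 = (exp 1 :: real)\<^sup>2"
  using exp_double[of "1 :: real"] by simp

text \<open>\<open>t ^ t / fact t\<close> is a single term of the exponential series at
  \<open>t\<close>.\<close>

lemma power_le_fact_mult_exp: "real t ^ t \<le> fact t * exp (real t)"
proof -
  have "(\<Sum>j\<in>{t}. inverse (fact j) *\<^sub>R real t ^ j) \<le> (\<Sum>j. inverse (fact j) *\<^sub>R real t ^ j)"
    by (intro sum_le_suminf summable_exp_generic) auto
  then have "real t ^ t / fact t \<le> exp (real t)"
    by (simp add: exp_def field_simps)
  then show ?thesis by (simp add: field_simps)
qed

text \<open>Bounding \<open>n choose t\<close> by \<open>n ^ t / fact t\<close> and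
  \<open>fact t\<close> from below by \<open>(t / e) ^ t\<close> turns the first moment bound into
  \<open>(e^2 * n / t^2) ^ t\<close>.\<close>

lemma lis_injections_upper_tail:
  assumes n: "1 \<le> n" and k: "n \<le> k" and s: "exp 1 * sqrt n \<le> s"
  shows "real (card {x \<in> injections k n. s \<le> real (lis x {1..n})}) / card (injections k n)
    \<le> (exp 2 * n / s\<^sup>2) powr s"
proof -
  \<comment> \<open>Lengths are integers, so reaching \<open>s\<close> and reaching \<open>t\<close>
    are the same event.\<close>
  define t where "t = nat \<lceil>s\<rceil>"
  have "0 < exp 1 * sqrt n" using n by simp
  with s have s0: "s > 0" by linarith
  then have t: "s \<le> real t" "t > 0" by (auto simp: t_def)
  have st: "s \<le> real l \<longleftrightarrow> t \<le> l" for l by (simp add: t_def nat_le_iff ceiling_le_iff)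
  have J: "real (card (injections k n)) > 0" using card_injections_pos[OF k] by simp
  define c where "c = real (card {x \<in> injections k n. s \<le> real (lis x {1..n})}) / card (injections k n)"
  have "real (fact t * card {x \<in> injections k n. t \<le> lis x {1..n}})
      \<le> real ((n choose t) * card (injections k n))"
    using card_lis_ge_le[of t k n] by (simp only: of_nat_le_iff)
  then have "fact t * c \<le> real (n choose t)" using J by (simp add: c_def st field_simps)
  then have "fact t * (fact t * c) \<le> fact t * real (n choose t)" by (intro mult_left_mono) auto
  also have "\<dots> = real ((n choose t) * fact t)" by simp
  also have "\<dots> \<le> real n ^ t" using binomial_fact_pow[of n t] by (simp only: of_nat_le_iff flip: of_nat_power)
  finally have c: "(fact t)\<^sup>2 * c \<le> real n ^ t" by (simp add: power2_eq_square mult.assoc)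
  have "(real t ^ t)\<^sup>2 * c \<le> (fact t * exp (real t))\<^sup>2 * c"
    using power_le_fact_mult_exp by (intro mult_right_mono power_mono) (auto simp: c_def)
  also have "\<dots> = (exp (real t))\<^sup>2 * ((fact t)\<^sup>2 * c)" by (simp add: power_mult_distrib)
  also have "\<dots> \<le> (exp (real t))\<^sup>2 * real n ^ t" using c by (intro mult_left_mono) auto
  also have "(exp (real t))\<^sup>2 = exp 2 ^ t" 
    by (simp add: mult.commute flip: exp_of_nat_mult exp_double)
  finally have "c \<le> exp 2 ^ t * real n ^ t / (real t ^ t)\<^sup>2" using t by (simp add: field_simps)
  also have "\<dots> = (exp 2 * n / (real t)\<^sup>2) ^ t"
    by (simp add: power_divide power_mult_distrib flip: power_mult) (simp add: mult.commute)
  also have "\<dots> \<le> (exp 2 * n / s\<^sup>2) ^ t"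
    using t s0 by (intro power_mono divide_left_mono) auto
  also have "\<dots> = (exp 2 * n / s\<^sup>2) powr t" using n s0 by (simp add: powr_realpow)
  \<comment> \<open>The assumption on \<open>s\<close> makes the base at most 1, so lowering the
    exponent from \<open>t\<close> to \<open>s\<close> does not decrease the power.\<close>
  also have "\<dots> \<le> (exp 2 * n / s\<^sup>2) powr s"
  proof (rule powr_mono')
    have "(exp 1 * sqrt n)\<^sup>2 \<le> s\<^sup>2" using s by (intro power_mono) auto
    then have "exp 2 * n \<le> s\<^sup>2" by (simp add: power_mult_distrib exp_two)
    then show "exp 2 * n / s\<^sup>2 \<le> 1" using s0 by simp
  qed (use t in auto)
  finally show ?thesis by (simp add: c_def)
qed

section \<open>Mean and tail bounds for planar matchings\<close>

lemma prob_max_planar_matching_ge: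
  assumes "n \<le> k" "real (card {x \<in> injections k n. \<not> P (lis x {1..n})}) / card (injections k n) \<le> \<delta>"
  shows "1 - \<delta> \<le> measure_pmf.prob (random_matching_graph k n) {G. P (max_planar_matching G)}"
proof -
  have "card (injections k n) = card {x \<in> injections k n. P (lis x {1..n})} +
      card {x \<in> injections k n. \<not> P (lis x {1..n})}"
    by (subst card_Un_disjoint[symmetric]) (auto simp: finite_injections intro: arg_cong[where f = card])
  then have "real (card {x \<in> injections k n. P (lis x {1..n})}) =
      real (card (injections k n)) - real (card {x \<in> injections k n. \<not> P (lis x {1..n})})" by linarith
  then have "real (card {x \<in> injections k n. P (lis x {1..n})}) / card (injections k n) =
      1 - real (card {x \<in> injections k n. \<not> P (lis x {1..n})}) / card (injections k n)"
    using card_injections_pos[OF assms(1)] by (simp add: diff_divide_distrib)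
  then show ?thesis using assms by (simp add: prob_random_matching_graph)
qed

text \<open>A length below \<open>sqrt (n / q)\<close> forces a reversed length of at least
  \<open>s = sqrt (n * q)\<close>, since their product is at least \<open>n\<close>. Reversal is
  injective, so the upper tail at \<open>s\<close> bounds the probability.\<close>

lemma planar_matching_lower_tail_log:
  fixes b :: real
  assumes n: "2 \<le> n" and k: "n \<le> k" and b: "2 < b" "b \<le> real n / (32 ^ 2 * ln (real n))"
  shows "1 - exp (- (b / 2 - 1) * ln (real n)) \<le>
    measure_pmf.prob (random_matching_graph k n)
      {G. sqrt (real n / (b * ln (real n))) \<le> real (max_planar_matching G)}"
proof -
  define q where "q = b * ln (real n)"
  define s where "s = sqrt (n * q)"
  have l2: "ln (real n) \<ge> ln 2" using n by simp
  then have l: "ln (real n) > 1 / 2" using ln2_ge_two_thirds by linarith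
  have nq: "1024 * q \<le> n" using b(2) l by (simp add: q_def field_simps)
  have q2: "q \<ge> 2 * ln (real n)" using b(1) l by (simp add: q_def)
  \<comment> \<open>Bootstrapping: \<open>q\<close> exceeds 1, hence \<open>n\<close> is at least
    1024, hence \<open>ln n\<close> is at least \<open>10 * ln 2\<close>, which in turn raises
    \<open>q\<close> to at least 13.\<close>
  then have "real n \<ge> 2 ^ 10" using nq l by simp
  then have "ln (real n) \<ge> ln (2 ^ 10)" using n by (subst ln_le_cancel_iff) auto
  moreover have "ln (2 ^ 10) = 10 * ln (2 :: real)" by (subst ln_realpow) auto
  ultimately have q: "q \<ge> 13" using q2 ln2_ge_two_thirds by linarith
  have e2: "exp 2 \<le> (7.5 :: real)"
  proof -
    have "(exp 1 :: real)\<^sup>2 \<le> 2.72\<^sup>2" using e_less_272 by (intro power_mono) auto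
    then show ?thesis by (simp add: exp_two power2_eq_square)
  qed
  have s32: "32 * q \<le> s"
  proof -
    have "(32 * q)\<^sup>2 \<le> n * q" using mult_right_mono[OF nq, of q] q by (simp add: power2_eq_square)
    then show ?thesis unfolding s_def by (rule real_le_rsqrt)
  qed
  have "exp 1 * sqrt n \<le> s"
  proof -
    have "(exp 1 * sqrt n)\<^sup>2 = exp 2 * n" by (simp add: power_mult_distrib exp_two)
    also have "\<dots> \<le> q * n" using e2 q by (intro mult_right_mono) auto
    also have "\<dots> = n * q" by (rule mult.commute)
    finally show ?thesis unfolding s_def by (rule real_le_rsqrt)
  qed
  then have tail: "real (card {x \<in> injections k n. s \<le> real (lis x {1..n})}) / card (injections k n)
      \<le> (exp 2 * n / s\<^sup>2) powr s"
    using n k by (intro lis_injections_upper_tail) auto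
  have base: "exp 2 * n / s\<^sup>2 = exp 2 / q" using n q by (simp add: s_def field_simps)
  \<comment> \<open>A crude bound suffices: a logarithm of at most \<open>- 1 / 32\<close> together
    with \<open>32 * q \<le> s\<close> makes the exponent at most \<open>- q\<close>.\<close>
  have "ln (exp 2 / q) \<le> exp 2 / q - 1" using q by (intro ln_le_minus_one) simp
  also have "\<dots> \<le> - 1 / 32" using q e2 by (simp add: field_simps)
  finally have "s * ln (exp 2 / q) \<le> s * (- 1 / 32)" using s32 q by (intro mult_left_mono) auto
  also have "\<dots> \<le> - q" using s32 by simp
  also have "\<dots> = - b * ln (real n)" by (simp add: q_def)
  also have "\<dots> \<le> - (b / 2 - 1) * ln (real n)"
    using b(1) l by (intro mult_right_mono) auto
  finally have bnd: "(exp 2 * n / s\<^sup>2) powr s \<le> exp (- (b / 2 - 1) * ln (real n))"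
    using q by (simp add: base powr_def)
  have sub: "rev_fun n ` {x \<in> injections k n. \<not> sqrt (n / q) \<le> real (lis x {1..n})}
      \<subseteq> {x \<in> injections k n. s \<le> real (lis x {1..n})}"
  proof (clarify, intro CollectI conjI)
    fix x assume x: "x \<in> injections k n" and "\<not> sqrt (n / q) \<le> real (lis x {1..n})"
    then have less: "real (lis x {1..n}) < sqrt (n / q)" by simp
    show "rev_fun n x \<in> injections k n" using x by (rule rev_fun_in_injections)
    show "s \<le> real (lis (rev_fun n x) {1..n})"
    proof (rule ccontr)
      assume "\<not> s \<le> real (lis (rev_fun n x) {1..n})"
      then have "real (lis x {1..n}) * real (lis (rev_fun n x) {1..n}) < sqrt (n / q) * s"
        using less by (intro mult_strict_mono') auto
      also have "\<dots> = n" using q by (simp add: s_def flip: real_sqrt_mult)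
      finally have "lis x {1..n} * lis (rev_fun n x) {1..n} < n"
        unfolding of_nat_mult[symmetric] of_nat_less_iff .
      moreover have "inj_on x {1..n}" using x by (simp add: injections_def)
      ultimately show False using lis_mult_lis_rev_fun by (simp add: not_le[symmetric])
    qed
  qed
  have "card {x \<in> injections k n. \<not> sqrt (n / q) \<le> real (lis x {1..n})}
      \<le> card {x \<in> injections k n. s \<le> real (lis x {1..n})}"
    by (rule card_inj_on_le[OF inj_on_subset[OF bij_betw_imp_inj_on[OF bij_betw_rev_fun]] sub])
       (auto simp: finite_injections)
  then have "real (card {x \<in> injections k n. \<not> sqrt (n / q) \<le> real (lis x {1..n})}) / card (injections k n)
      \<le> real (card {x \<in> injections k n. s \<le> real (lis x {1..n})}) / card (injections k n)"
    by (intro divide_right_mono) auto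
  also note tail
  also note bnd
  finally show ?thesis
    unfolding q_def by (rule prob_max_planar_matching_ge[OF k])
qed

text \<open>At this threshold the base of the upper tail is the constant
  \<open>(1 + \<epsilon> / e) ^ (-2)\<close>, less than 1, and the exponent is proportional to
  \<open>sqrt n\<close>.\<close>

lemma planar_matching_upper_tail:
  fixes \<epsilon> :: real
  assumes \<epsilon>: "0 < \<epsilon>" and n: "1 \<le> n" and k: "n \<le> k"
  shows "real (card {x \<in> injections k n. (exp 1 + \<epsilon>) * sqrt n \<le> real (lis x {1..n})})
    / card (injections k n) \<le> exp (- (2 * (exp 1 + \<epsilon>) * ln (1 + \<epsilon> / exp 1)) * sqrt n)"
proof -
  define s where "s = (exp 1 + \<epsilon>) * sqrt n"
  have e: "exp 1 + \<epsilon> > 0" using \<epsilon> by (simp add: add_pos_pos)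
  have "exp 2 * n / s\<^sup>2 = (exp 1 / (exp 1 + \<epsilon>))\<^sup>2"
    using n by (simp add: s_def power_mult_distrib power_divide exp_two)
  also have "exp 1 / (exp 1 + \<epsilon>) = inverse (1 + \<epsilon> / exp 1)"
    using e by (simp add: field_simps)
  finally have "(exp 2 * n / s\<^sup>2) powr s = exp (s * ln ((inverse (1 + \<epsilon> / exp 1))\<^sup>2))"
    using \<epsilon> by (simp add: powr_def add_pos_pos less_imp_neq[symmetric])
  also have "ln ((inverse (1 + \<epsilon> / exp 1))\<^sup>2) = - 2 * ln (1 + \<epsilon> / exp 1)"
    using \<epsilon> by (simp add: ln_realpow ln_inverse add_pos_pos)
  finally have "(exp 2 * n / s\<^sup>2) powr s = exp (- (2 * (exp 1 + \<epsilon>) * ln (1 + \<epsilon> / exp 1)) * sqrt n)"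
    by (simp add: s_def mult_ac)
  moreover have "exp 1 * sqrt n \<le> s" using \<epsilon> by (simp add: s_def mult_right_mono)
  ultimately show ?thesis
    using lis_injections_upper_tail[OF n k, of s] by (simp add: s_def)
qed

lemma planar_matching_bounds:
  fixes \<epsilon> :: real
  assumes \<epsilon>: "0 < \<epsilon>"
  obtains C\<^sub>0 C\<^sub>1 :: real where "0 < C\<^sub>0" "0 < C\<^sub>1" "\<And>n k. 1 \<le> n \<Longrightarrow> C\<^sub>0 \<le> real n \<Longrightarrow> n \<le> k \<Longrightarrow>
     mu_low n \<le> measure_pmf.expectation (random_matching_graph k n) (\<lambda>G. real (max_planar_matching G)) \<and>
     measure_pmf.expectation (random_matching_graph k n) (\<lambda>G. real (max_planar_matching G)) \<le> mu_up \<epsilon> n \<and>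
     1 - exp (- C\<^sub>1 * sqrt (real n)) \<le>
       measure_pmf.prob (random_matching_graph k n) {G. real (max_planar_matching G) \<le> mu_up \<epsilon> n} \<and>
     1 - z_bound (1 / 2) 16 k n \<le>
       measure_pmf.prob (random_matching_graph k n) {G. (1 - \<epsilon>) * mu_low n \<le> real (max_planar_matching G)}"
proof -
  define C\<^sub>1 where "C\<^sub>1 = 2 * (exp 1 + \<epsilon>) * ln (1 + \<epsilon> / exp 1)"
  have C1: "C\<^sub>1 > 0" using \<epsilon> by (simp add: C\<^sub>1_def add_pos_pos ln_gt_zero)
  \<comment> \<open>This quantity bounds what overlong subsequences, each of length at most
    \<open>n\<close>, add to the mean; the \<open>+ 1\<close> in \<open>mu_up\<close> absorbs
    it.\<close>
  have "eventually (\<lambda>n. real n * exp (- C\<^sub>1 * sqrt (real n)) \<le> 1) sequentially"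
    using C1 by real_asymp
  then obtain n\<^sub>0 where n0: "\<And>n. n\<^sub>0 \<le> n \<Longrightarrow> real n * exp (- C\<^sub>1 * sqrt (real n)) \<le> 1"
    by (auto simp: eventually_sequentially)
  \<comment> \<open>From 1024 on, \<open>sqrt n\<close> is at least 32, so \<open>mu_low\<close> is
    nonnegative and \<open>16 / sqrt n\<close> is at most \<open>1 / 2\<close>, the chosen cap in
    \<open>z_bound\<close>.\<close>
  define C\<^sub>0 where "C\<^sub>0 = real (max n\<^sub>0 1024)"
  show thesis
  proof (rule that[of C\<^sub>0 C\<^sub>1])
    show "0 < C\<^sub>0" by (simp add: C\<^sub>0_def)
    show "0 < C\<^sub>1" by (rule C1)
  next
    fix n k :: nat assume n: "1 \<le> n" and large: "C\<^sub>0 \<le> real n" and k: "n \<le> k"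
    have n1: "n\<^sub>0 \<le> n" "1024 \<le> n" using large by (auto simp: C\<^sub>0_def)
    have sq: "sqrt n \<ge> 32" using n1(2) by (intro real_le_rsqrt) simp
    define J where "J = injections k n"
    define E where "E = (\<Sum>x\<in>J. real (lis x {1..n})) / card J"
    have J: "real (card J) > 0" using card_injections_pos[OF k] by (simp add: J_def)
    have fJ: "finite J" by (simp add: J_def finite_injections)
    define s where "s = (exp 1 + \<epsilon>) * sqrt n"
    have s: "s > 0" using \<epsilon> n by (simp add: s_def add_pos_pos)
    define B where "B = {x \<in> J. s \<le> real (lis x {1..n})}"
    have B: "card B / card J \<le> exp (- C\<^sub>1 * sqrt n)"
      using planar_matching_upper_tail[OF \<epsilon> n k] by (simp add: B_def J_def s_def C\<^sub>1_def)
    have "sqrt n \<le> E"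
      using sum_lis_injections_ge[of n k] J by (simp add: E_def J_def le_divide_eq)
    moreover have low: "0 \<le> mu_low n" "mu_low n \<le> 0.65 * sqrt n"
    proof -
      have e: "exp (- 1 :: real) \<ge> 0.35" "exp (- 1 :: real) \<le> 1 / 2"
        using e_less_272 exp_ge_add_one_self[of "1 :: real"] by (auto simp: exp_minus field_simps)
      have "17 / sqrt n \<le> 1" using sq by (subst divide_le_eq_1_pos) linarith+
      also have "\<dots> \<le> (1 - exp (- 1)) * 32" using e by simp
      also have "\<dots> \<le> (1 - exp (- 1)) * sqrt n" using e sq by (intro mult_left_mono) auto
      finally show "0 \<le> mu_low n" by (simp add: mu_low_def)
      have "(1 - exp (- 1)) * sqrt n \<le> 0.65 * sqrt n" using e sq by (intro mult_right_mono) auto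
      moreover have "17 / sqrt n \<ge> 0" by simp
      ultimately show "mu_low n \<le> 0.65 * sqrt n" unfolding mu_low_def by linarith
    qed
    moreover have "0.65 * sqrt n \<le> sqrt n" by simp
    ultimately have E_low: "mu_low n \<le> E" by (meson order_trans)
    \<comment> \<open>Truncation at \<open>s\<close>: outside \<open>B\<close> the length is below
      \<open>s\<close>, and on \<open>B\<close> it is at most \<open>n\<close>.\<close>
    have "real (lis x {1..n}) \<le> s + (if x \<in> B then real n else 0)" if "x \<in> J" for x
      using that lis_le_card[of "{1..n}" x] s by (auto simp: B_def)
    then have "(\<Sum>x\<in>J. real (lis x {1..n})) \<le> (\<Sum>x\<in>J. s + (if x \<in> B then real n else 0))"
      by (rule sum_mono)
    also have "\<dots> = card J * s + card B * real n"
      using fJ by (simp add: sum.distrib sum.If_cases B_def Int_def)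
    finally have "E \<le> s + real n * (card B / card J)"
      using J by (simp add: E_def field_simps)
    also have "\<dots> \<le> s + real n * exp (- C\<^sub>1 * sqrt n)" using B by (intro add_left_mono mult_left_mono) auto
    also have "\<dots> \<le> s + 1" using n0[OF n1(1)] by simp
    finally have E_up: "E \<le> mu_up \<epsilon> n" by (simp add: mu_up_def s_def)
    have "card {x \<in> J. \<not> real (lis x {1..n}) \<le> mu_up \<epsilon> n} \<le> card B"
      using fJ by (intro card_mono) (auto simp: B_def mu_up_def s_def)
    then have "card {x \<in> J. \<not> real (lis x {1..n}) \<le> mu_up \<epsilon> n} / card J \<le> card B / card J"
      by (intro divide_right_mono) auto
    also note B
    finally have up: "1 - exp (- C\<^sub>1 * sqrt (real n)) \<le>
       measure_pmf.prob (random_matching_graph k n) {G. real (max_planar_matching G) \<le> mu_up \<epsilon> n}"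
      unfolding J_def by (rule prob_max_planar_matching_ge[OF k])
    \<comment> \<open>As \<open>mu_low\<close> is nonnegative, the factor
      \<open>1 - \<epsilon>\<close> may be replaced by 1, even where it is negative.\<close>
    have "(1 - \<epsilon>) * mu_low n \<le> 1 * mu_low n" using low \<epsilon> by (intro mult_right_mono) auto
    with low(2) have "(1 - \<epsilon>) * mu_low n \<le> 0.65 * sqrt n" by linarith
    then have "card {x \<in> J. \<not> (1 - \<epsilon>) * mu_low n \<le> real (lis x {1..n})}
        \<le> card {x \<in> J. real (lis x {1..n}) < 0.65 * sqrt n}"
      using fJ by (intro card_mono) auto
    then have "card {x \<in> J. \<not> (1 - \<epsilon>) * mu_low n \<le> real (lis x {1..n})} / card J
        \<le> card {x \<in> J. real (lis x {1..n}) < 0.65 * sqrt n} / card J"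
      by (intro divide_right_mono) auto
    also have "\<dots> \<le> 16 / sqrt n"
      unfolding J_def by (rule lis_injections_lower_tail[OF n k])
    also have "\<dots> \<le> z_bound (1 / 2) 16 k n"
    proof -
      \<comment> \<open>Both arguments of the minimum dominate \<open>16 / sqrt n\<close>; the
        summand with \<open>n / k\<close> only enlarges the second.\<close>
      have "16 / sqrt n \<le> 16 / 32" using sq n by (intro divide_left_mono) auto
      then show ?thesis by (simp add: z_bound_def)
    qed
    finally have "1 - z_bound (1 / 2) 16 k n \<le>
       measure_pmf.prob (random_matching_graph k n) {G. (1 - \<epsilon>) * mu_low n \<le> real (max_planar_matching G)}"
      unfolding J_def by (rule prob_max_planar_matching_ge[OF k])
    then show "mu_low n \<le> measure_pmf.expectation (random_matching_graph k n) (\<lambda>G. real (max_planar_matching G)) \<and>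
     measure_pmf.expectation (random_matching_graph k n) (\<lambda>G. real (max_planar_matching G)) \<le> mu_up \<epsilon> n \<and>
     1 - exp (- C\<^sub>1 * sqrt (real n)) \<le>
       measure_pmf.prob (random_matching_graph k n) {G. real (max_planar_matching G) \<le> mu_up \<epsilon> n} \<and>
     1 - z_bound (1 / 2) 16 k n \<le>
       measure_pmf.prob (random_matching_graph k n) {G. (1 - \<epsilon>) * mu_low n \<le> real (max_planar_matching G)}"
      using E_low E_up up expectation_random_matching_graph[OF k] by (simp add: E_def J_def)
  qed
qed

theorem theorem3p1:
  "(\<forall>\<epsilon>::real. \<epsilon> > 0 \<longrightarrow>
      (\<exists>C\<^sub>0 C\<^sub>1 C\<^sub>2 D\<^sub>0 :: real. C\<^sub>0 > 0 \<and> C\<^sub>1 > 0 \<and> C\<^sub>2 > 0 \<and> 0 < D\<^sub>0 \<and> D\<^sub>0 < 1 \<and>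
        (\<forall>n k :: nat. 1 \<le> n \<longrightarrow> C\<^sub>0 \<le> real n \<longrightarrow> n \<le> k \<longrightarrow>
           mu_low n \<le> measure_pmf.expectation (random_matching_graph k n)
                          (\<lambda>G. real (max_planar_matching G)) \<and>
           measure_pmf.expectation (random_matching_graph k n)
                          (\<lambda>G. real (max_planar_matching G)) \<le> mu_up \<epsilon> n \<and>
           measure_pmf.prob (random_matching_graph k n)
               {G. real (max_planar_matching G) \<le> mu_up \<epsilon> n}
             \<ge> 1 - exp (- C\<^sub>1 * sqrt (real n)) \<and>
           measure_pmf.prob (random_matching_graph k n)
               {G. real (max_planar_matching G) \<ge> (1 - \<epsilon>) * mu_low n}
             \<ge> 1 - z_bound D\<^sub>0 C\<^sub>2 k n)))
   \<and>
   (\<forall>(n::nat) (k::nat) (b::real). 2 \<le> n \<longrightarrow> n \<le> k \<longrightarrow>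
      2 < b \<longrightarrow> b \<le> real n / (32 ^ 2 * ln (real n)) \<longrightarrow>
        measure_pmf.prob (random_matching_graph k n)
            {G. real (max_planar_matching G) \<ge> sqrt (real n / (b * ln (real n)))}
          \<ge> 1 - exp (- (b / 2 - 1) * ln (real n)))"
proof (intro conjI allI impI)
  fix \<epsilon> :: real assume \<epsilon>: "\<epsilon> > 0"
  obtain C\<^sub>0 C\<^sub>1 :: real where "0 < C\<^sub>0" "0 < C\<^sub>1" "\<And>n k. 1 \<le> n \<Longrightarrow> C\<^sub>0 \<le> real n \<Longrightarrow> n \<le> k \<Longrightarrow>
     mu_low n \<le> measure_pmf.expectation (random_matching_graph k n) (\<lambda>G. real (max_planar_matching G)) \<and>
     measure_pmf.expectation (random_matching_graph k n) (\<lambda>G. real (max_planar_matching G)) \<le> mu_up \<epsilon> n \<and>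
     1 - exp (- C\<^sub>1 * sqrt (real n)) \<le>
       measure_pmf.prob (random_matching_graph k n) {G. real (max_planar_matching G) \<le> mu_up \<epsilon> n} \<and>
     1 - z_bound (1 / 2) 16 k n \<le>
       measure_pmf.prob (random_matching_graph k n) {G. (1 - \<epsilon>) * mu_low n \<le> real (max_planar_matching G)}"
    by (rule planar_matching_bounds[OF \<epsilon>]) blast
  then show "\<exists>C\<^sub>0 C\<^sub>1 C\<^sub>2 D\<^sub>0 :: real. C\<^sub>0 > 0 \<and> C\<^sub>1 > 0 \<and> C\<^sub>2 > 0 \<and> 0 < D\<^sub>0 \<and> D\<^sub>0 < 1 \<and>
        (\<forall>n k :: nat. 1 \<le> n \<longrightarrow> C\<^sub>0 \<le> real n \<longrightarrow> n \<le> k \<longrightarrow>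
           mu_low n \<le> measure_pmf.expectation (random_matching_graph k n)
                          (\<lambda>G. real (max_planar_matching G)) \<and>
           measure_pmf.expectation (random_matching_graph k n)
                          (\<lambda>G. real (max_planar_matching G)) \<le> mu_up \<epsilon> n \<and>
           measure_pmf.prob (random_matching_graph k n)
               {G. real (max_planar_matching G) \<le> mu_up \<epsilon> n}
             \<ge> 1 - exp (- C\<^sub>1 * sqrt (real n)) \<and>
           measure_pmf.prob (random_matching_graph k n)
               {G. real (max_planar_matching G) \<ge> (1 - \<epsilon>) * mu_low n}
             \<ge> 1 - z_bound D\<^sub>0 C\<^sub>2 k n)"
    by (intro exI[of _ C\<^sub>0] exI[of _ C\<^sub>1] exI[of _ 16] exI[of _ "1 / 2"]) simp
next
  fix n k :: nat and b :: real
  assume "2 \<le> n" "n \<le> k" "2 < b" "b \<le> real n / (32 ^ 2 * ln (real n))"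
  then show "measure_pmf.prob (random_matching_graph k n)
            {G. real (max_planar_matching G) \<ge> sqrt (real n / (b * ln (real n)))}
          \<ge> 1 - exp (- (b / 2 - 1) * ln (real n))"
    by (rule planar_matching_lower_tail_log)
qed

end
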